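(* Let $C$ be the modular curve with LMFDB label 8.48.1.bi.1, i.e. the smooth genus one curve over $\mathbb{Q}$ given in $\mathbb{P}^3$ (coordinates $x,y,z,w$) by \begin{align*} 2x^2 + 3xy + yz - z^2 + w^2&=0, \\ 4x^2 - 2xy + y^2 - 2yz + 2z^2&=0. \end{align*} Then $C$ has no quadratic points. In particular, $C$ has index greater than $2$.
   Context: A quadratic point of a curve $C$ over $\mathbb{Q}$ is a point $P\in C(\overline{\mathbb{Q}})$ whose residue field $\mathbb{Q}(P)$ has degree at most $2$ over $\mathbb{Q}$. The index of a genus one curve $C/\mathbb{Q}$ is the smallest degree of an extension $L/\mathbb{Q}$ with $C(L)\ne\emptyset$. *)

theory Defs
  imports "HOL-Algebra.Algebraic_Closure_Type" "HOL-Algebra.Generated_Fields" "HOL-Analysis.Cartesian_Space"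
begin

unbundle no fps_syntax

text \<open>
  All fields below are subfields of the complex numbers. This loses nothing, since every algebraic
  extension of \<open>\<rat>\<close> embeds into them.
\<close>

abbreviation complex_field :: "complex ring"
  where "complex_field \<equiv> ring_of_type_algebra"

definition Qbar :: "complex set"
  where "Qbar = {z. algebraic z}"

text \<open>
  \<open>has_degree L n\<close> says that \<open>L\<close> is finite-dimensional over \<open>\<rat>\<close>, of dimension exactly \<open>n\<close>.
\<close>

definition has_degree :: "complex set \<Rightarrow> nat \<Rightarrow> bool"
  where "has_degree L n \<longleftrightarrow> ring.dimension complex_field n \<rat> L"

definition proportional :: "((complex^'n) \<times> (complex^'n)) set"
  where "proportional = {(u, v). \<exists>c. c \<noteq> 0 \<and> v = c *s u}"

definition proj_space :: "(complex^'n) set set"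
  where "proj_space = (UNIV - {0}) // proportional"

text \<open>
  A projective variety is represented by its set \<open>V\<close> of complex points; \<open>points_over V L\<close> is the
  set \<open>V(L)\<close>, consisting of the points with a representative whose coordinates all lie in \<open>L\<close>.
\<close>

definition points_over :: "(complex^'n) set set \<Rightarrow> complex set \<Rightarrow> (complex^'n) set set"
  where "points_over V L = {P \<in> V. \<exists>v\<in>P. \<forall>i. v $ i \<in> L}"

text \<open>
  The residue field \<open>\<rat>(P)\<close> is generated by the ratios of the homogeneous coordinates of \<open>P\<close>, which
  do not depend on the representative.
\<close>

definition residue_field :: "(complex^'n) set \<Rightarrow> complex set"
  where "residue_field P =
    generate_field complex_field {v $ i / v $ j | v i j. v \<in> P \<and> v $ j \<noteq> 0}"

definition quadratic_points :: "(complex^'n) set set \<Rightarrow> (complex^'n) set set"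
  where "quadratic_points V =
    {P \<in> points_over V Qbar. \<exists>n\<le>2. has_degree (residue_field P) n}"

definition curve_index :: "(complex^'n) set set \<Rightarrow> nat"
  where "curve_index V =
    (LEAST n. \<exists>L. subfield L complex_field \<and> has_degree L n \<and> points_over V L \<noteq> {})"

definition curve_8_48_1_bi_1 :: "(complex^4) set set"
  where "curve_8_48_1_bi_1 = {P \<in> proj_space. \<forall>v\<in>P.
    (let x = v $ 1; y = v $ 2; z = v $ 3; w = v $ 4 in
      2 * x^2 + 3 * x * y + y * z - z^2 + w^2 = 0 \<and>
      4 * x^2 - 2 * x * y + y^2 - 2 * y * z + 2 * z^2 = 0)}"

end

theory Submission
  imports Defs
begin

text \<open>
  Write \<open>A\<close> and \<open>B\<close> for the two quadrics that cut out the curve. The form \<open>B\<close> involves only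
  \<open>x, y, z\<close> and is positive definite in them, so the curve has no real points, and in particular
  no rational ones.

  A point of degree two can be written as \<open>p + q \<surd>D\<close> with \<open>p\<close>, \<open>q\<close> rational, and together with its
  conjugate \<open>p - q \<surd>D\<close> it spans a line defined over \<open>\<rat>\<close>. A quadric of the pencil generated by \<open>A\<close>
  and \<open>B\<close> restricts to this line as a rational binary quadratic form vanishing at these two points.
  Such forms are proportional, so some member of the pencil with rational coefficients contains
  the whole line. That member is not \<open>B\<close>, whose only real zero is \<open>(0 : 0 : 0 : 1)\<close>, so up to scaling
  it is \<open>G = 2 A + B + u B\<close> for a rational number \<open>u\<close>. Two facts about \<open>G\<close> now contradict each other.

  \<^item> The form \<open>2 A + B = (2 x + y)\<^sup>2 + 4 x\<^sup>2 + 2 w\<^sup>2\<close> is positive semidefinite, so for \<open>u \<ge> 0\<close> the quadric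
    \<open>G = 0\<close> has at most one real point. Hence \<open>u < 0\<close>.

  \<^item> A quadratic form in four variables that vanishes on a line has square determinant
    (lemma \<open>isotropic_plane_det_square\<close>). The determinant of \<open>G\<close> is \<open>4 u (u\<^sup>2 + 12 u + 4)\<close>, and this is
    not a square for any rational \<open>u < 0\<close> (lemma \<open>negative_component_no_rational_point\<close>).

  The second assertion says that the bounded real component of the elliptic curve
  \<open>s\<^sup>2 = u (u\<^sup>2 + 12 u + 4)\<close> has no rational points. It follows from a descent: coprimality turns the
  factors of the right-hand side into squares up to powers of \<open>2\<close>, and the
  equations between these squares are impossible modulo powers of \<open>2\<close>.

  The remaining parts connect this with the algebraic definitions: a subfield of degree at most
  two consists of numbers \<open>a + b \<theta>\<close> with \<open>\<theta>\<^sup>2\<close> rational, and the index, which is a minimum, is attained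
  because the curve does have a point over some number field.
\<close>

section \<open>Negative arguments of the determinant\<close>

lemma coprime_mult_eq_square:
  fixes a b c :: int
  assumes "coprime a b" "a \<ge> 0" "b \<ge> 0" "a * b = c\<^sup>2"
  shows "\<exists>d. b = d\<^sup>2"
proof -
  have "nat a * nat b = nat \<bar>c\<bar> ^ 2"
    using assms by (metis abs_ge_zero nat_mult_distrib nat_power_eq power2_abs)
  then have "is_nth_power 2 (nat a * nat b)" by (auto intro: is_nth_powerI)
  moreover have "coprime (nat a) (nat b)"
    using assms by (metis coprime_int_iff int_nat_eq)
  ultimately have "is_nth_power 2 (nat b)"
    by (simp add: is_nth_power_mult_coprime_nat_iff)
  then obtain d where "nat b = d ^ 2" by (auto elim: is_nth_powerE)
  then have "b = (int d)\<^sup>2" using assms(3) by (metis int_nat_eq of_nat_power)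
  then show ?thesis by blast
qed

lemma square_mod_4: "(d::int)\<^sup>2 mod 4 = (if even d then 0 else 1)"
proof (cases "even d")
  case True
  then obtain k where "d = 2*k" by blast
  then show ?thesis by (simp add: power2_eq_square)
next
  case False
  then obtain k where "d = 2*k+1" by (elim oddE)
  then have "d\<^sup>2 = 1 + 4*(k\<^sup>2+k)" by (simp add: power2_eq_square algebra_simps)
  then have "d\<^sup>2 mod 4 = 1" by presburger
  then show ?thesis using False by simp
qed

lemma even_of_difference_1_mod_4: "x = y + 2 * z \<Longrightarrow> x mod 4 = 1 \<Longrightarrow> y mod 4 = 1 \<Longrightarrow> even (z::int)"
  by presburger

lemma coprime_mult_diff:
  fixes a r t :: int
  assumes "coprime a r"
  shows "coprime a (a * t - r)"
proof (rule coprimeI)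
  fix c assume "c dvd a" "c dvd a * t - r"
  then have "c dvd r" by (metis dvd_diff_right_iff dvd_mult2)
  with \<open>c dvd a\<close> assms show "is_unit c" by (rule_tac coprime_common_divisor)
qed

text \<open>
  This is \<open>s\<^sup>2 = u (u\<^sup>2 + 12 u + 4)\<close> for \<open>u = - m / n\<close>, cleared of denominators. The last factor has no odd
  prime in common with \<open>m n\<close>. So, after division by a suitable power of \<open>2\<close>, it is a square itself,
  but its residue modulo \<open>4\<close> turns out to be \<open>2\<close> or \<open>3\<close>. The relevant power of \<open>2\<close> depends on the
  residue of \<open>m\<close> modulo \<open>4\<close>.
\<close>

lemma descent_no_square:
  fixes m n s :: int
  assumes "coprime m n" "m > 0" "n > 0"
  shows "m * n * (12 * m * n - m\<^sup>2 - 4 * n\<^sup>2) \<noteq> s\<^sup>2"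
proof
  assume eq: "m * n * (12 * m * n - m\<^sup>2 - 4 * n\<^sup>2) = s\<^sup>2"
  show False
  proof (cases "even m")
    case False
    define K where "K = 12 * m * n - m\<^sup>2 - 4 * n\<^sup>2"
    have "coprime m 4" using False
      by (metis coprime_power_right_iff coprime_right_2_iff_odd numeral_Bit0_eq_double
          numeral_times_numeral power2_eq_square mult_2)
    then have "coprime m (4*n\<^sup>2)" using assms False by auto
    then have "coprime m (m * (12 * n - m) - 4*n\<^sup>2)" by (rule coprime_mult_diff)
    moreover have "coprime n (n * (12 * m - 4 * n) - m\<^sup>2)"
      using assms by (intro coprime_mult_diff) (auto simp: coprime_commute)
    ultimately have "coprime (m*n) K" 
      by (simp add: K_def power2_eq_square algebra_simps)
    moreover have "K \<ge> 0" using eq assms unfolding K_def[symmetric]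
      by (metis mult_pos_pos zero_le_mult_iff zero_le_power2 linorder_not_less)
    ultimately obtain d where d: "K = d\<^sup>2"
      using coprime_mult_eq_square[of "m*n" K s] eq assms K_def by auto
    \<comment> \<open>An odd square would be congruent to \<open>- m\<^sup>2\<close>, that is to \<open>3\<close>, modulo \<open>4\<close>.\<close>
    have "K = 4 * (3 * m * n - n\<^sup>2) - m\<^sup>2" by (simp add: K_def)
    then have "4 * (3 * m * n - n\<^sup>2) = d\<^sup>2 + m\<^sup>2" using d by simp
    then have "(d\<^sup>2 + m\<^sup>2) mod 4 = 0" by presburger
    then show False using False square_mod_4[of d] square_mod_4[of m] by presburger
  next
    case True
    then obtain h where h: "m = 2 * h" by blast
    then have hn: "coprime h n" "odd n" "h > 0" using assms by auto
    define K where "K = 6 * h * n - h\<^sup>2 - n\<^sup>2"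
    have eq': "8 * h * n * K = s\<^sup>2"
      using eq by (simp add: K_def h power2_eq_square algebra_simps)
    then have "even (s\<^sup>2)" by (metis dvd_mult2 dvd_triv_left even_mult_iff even_numeral)
    then obtain r where r: "s = 2 * r" by auto
    have "4 * (2 * h * n * K) = 4 * r\<^sup>2"
      using eq' by (simp add: r power2_eq_square algebra_simps)
    then have eq2: "2 * h * n * K = r\<^sup>2" by (simp only: mult_left_cancel[OF zero_neq_numeral[symmetric]])
    have K0: "K \<ge> 0"
    proof (rule ccontr)
      assume "\<not> K \<ge> 0"
      then have "2 * h * n * K < 0" using hn assms by (simp add: mult_pos_neg)
      then show False using eq2 by (metis not_less zero_le_power2)
    qed
    have "coprime h (h * (6 * n - h) - n\<^sup>2)" using hn
      by (intro coprime_mult_diff) auto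
    moreover have "coprime n (n * (6 * h - n) - h\<^sup>2)" using hn
      by (intro coprime_mult_diff) (auto simp: coprime_commute)
    ultimately have cop: "coprime (h * n) K"
      by (simp add: K_def power2_eq_square algebra_simps)
    show False
    proof (cases "even h")
      case True
      have "odd K" using True hn by (simp add: K_def)
      then have "coprime (2 * h * n) K" using cop by auto
      then obtain d where d: "K = d\<^sup>2"
        using coprime_mult_eq_square[of "2*h*n" K r] eq2 hn assms K0 by auto
      obtain k where "h = 2 * k" using True by blast
      then have "4 * (3 * k * n - k\<^sup>2) = d\<^sup>2 + n\<^sup>2" using d by (simp add: K_def power2_eq_square)
      then have "(d\<^sup>2 + n\<^sup>2) mod 4 = 0" by presburger
      then show False using hn square_mod_4[of d] square_mod_4[of n] by presburger
    next
      case False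
      \<comment> \<open>Now \<open>K\<close> is even and its half is a square as well as the coprime factor \<open>h n\<close>. The latter makes
        \<open>h - n\<close> divisible by \<open>4\<close>, and then \<open>K / 2\<close> is \<open>2\<close> modulo \<open>4\<close>.\<close>
      then have "even K" using hn by (simp add: K_def)
      then obtain J where J: "K = 2 * J" by blast
      have "even (r\<^sup>2)" using eq2 by (metis dvd_mult2 dvd_triv_left)
      then obtain t where t: "r = 2 * t" by auto
      have "4 * (h * n * J) = 4 * t\<^sup>2"
        using eq2 by (simp add: J t power2_eq_square algebra_simps)
      then have eq3: "h * n * J = t\<^sup>2" by (simp only: mult_left_cancel[OF zero_neq_numeral[symmetric]])
      have "coprime (h * n) J" using cop by (simp add: J)
      moreover have "J \<ge> 0" "h * n \<ge> 0" using K0 hn assms by (auto simp: J)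
      ultimately obtain d e where d: "J = d\<^sup>2" and e: "h * n = e\<^sup>2"
        using coprime_mult_eq_square[of "h*n" J t] coprime_mult_eq_square[of J "h*n" t] eq3
        by (metis coprime_commute mult.commute)
      have "odd e" using e False hn by (metis even_mult_iff power2_eq_square)
      have "even (h - n)" using False hn by simp
      then obtain k where "h - n = 2 * k" by blast
      then have k: "h = n + 2 * k" by simp
      have "2 * J = 4 * (h * n) - 4 * k\<^sup>2"
        unfolding J[symmetric] K_def k by (simp add: power2_eq_square algebra_simps)
      then have *: "d\<^sup>2 + 2 * k\<^sup>2 = 2 * e\<^sup>2" using d e by simp
      have "e\<^sup>2 = n\<^sup>2 + 2 * (k * n)"
        using e by (simp add: k power2_eq_square algebra_simps)
      moreover have "e\<^sup>2 mod 4 = 1" "n\<^sup>2 mod 4 = 1"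
        using square_mod_4[of e] square_mod_4[of n] \<open>odd e\<close> hn by simp_all
      ultimately have "even (k * n)" using even_of_difference_1_mod_4 by blast
      then obtain l where "k = 2 * l" using hn by auto
      then have "d\<^sup>2 + 8 * l\<^sup>2 = 2 * e\<^sup>2" using * by (simp add: power2_eq_square)
      then show False using \<open>odd e\<close> square_mod_4[of d] square_mod_4[of e] by presburger
    qed
  qed
qed

lemma rat_square_eq_int:
  fixes r :: rat
  assumes "r\<^sup>2 = of_int k"
  shows "\<exists>t. r = of_int t"
proof -
  obtain a b where ab: "quotient_of r = (a, b)" by fastforce
  then have r: "r = of_int a / of_int b" and b: "b > 0" and cop: "coprime a b"
    using quotient_of_div quotient_of_denom_pos quotient_of_coprime by auto
  have "of_int (a\<^sup>2) = (of_int (k * b\<^sup>2) :: rat)"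
    using assms b by (simp add: r power_divide field_simps)
  then have "a\<^sup>2 = k * b\<^sup>2" by (simp only: of_int_eq_iff)
  then have "b\<^sup>2 dvd a\<^sup>2" by simp
  then have "b dvd a" by simp
  then have "is_unit b" using cop \<open>b dvd a\<close> by (auto intro: coprime_common_divisor)
  then have "b = 1" using b by simp
  then show ?thesis using r by auto
qed

lemma negative_component_no_rational_point:
  fixes u s :: rat
  assumes "u < 0"
  shows "u * (u\<^sup>2 + 12 * u + 4) \<noteq> s\<^sup>2"
proof
  assume eq: "u * (u\<^sup>2 + 12 * u + 4) = s\<^sup>2"
  obtain a n where an: "quotient_of u = (a, n)" by fastforce
  then have u: "u = of_int a / of_int n" and n: "n > 0" and cop: "coprime a n"
    using quotient_of_div quotient_of_denom_pos quotient_of_coprime by auto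
  have a: "a < 0" using assms u n by (simp add: divide_less_0_iff)
  define m where "m = - a"
  define r where "r = s * of_int n ^ 2"
  have "of_int (m * n * (12 * m * n - m\<^sup>2 - 4 * n\<^sup>2)) = r\<^sup>2"
  proof -
    have "r\<^sup>2 = s\<^sup>2 * of_int n ^ 4" by (simp add: r_def power2_eq_square power4_eq_xxxx)
    also have "\<dots> = u * (u\<^sup>2 + 12 * u + 4) * of_int n ^ 4" unfolding eq[symmetric] by simp
    also have "\<dots> = of_int (m * n * (12 * m * n - m\<^sup>2 - 4 * n\<^sup>2))"
      using n by (simp add: u m_def field_simps power2_eq_square power4_eq_xxxx)
    finally show ?thesis by simp
  qed
  moreover from this obtain t where "r = of_int t"
    by (metis rat_square_eq_int)
  ultimately have "m * n * (12 * m * n - m\<^sup>2 - 4 * n\<^sup>2) = t\<^sup>2"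
    by (metis of_int_eq_iff of_int_power)
  then show False using descent_no_square[of m n t] cop a n by (simp add: m_def)
qed

section \<open>Quadrics containing a line\<close>

text \<open>
  The quadratic form in question is a binary form in the first two variables plus \<open>c z\<^sup>2 + d w\<^sup>2\<close>, so
  its Gram matrix \<open>M\<close> has determinant \<open>(\<alpha> \<gamma> - \<beta>\<^sup>2) c d\<close>. Complete the isotropic vectors \<open>p\<close>, \<open>q\<close> by two unit vectors
  to a basis. In this basis the Gram matrix has a zero \<open>2 \<times> 2\<close> diagonal block, so its determinant is
  the square of the determinant of an off-diagonal block; and it differs from \<open>det M\<close> by
  the square of the determinant of the base change, which is a \<open>2 \<times> 2\<close> minor of \<open>(p, q)\<close>. There is
  one case for each minor that can be non-zero.
\<close>

lemma isotropic_plane_det_square: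
  fixes \<alpha> \<beta> \<gamma> c d :: "'a::field"
  assumes p: "\<gamma> * p1\<^sup>2 + 2 * \<beta> * p1 * p2 + \<alpha> * p2\<^sup>2 + c * p3\<^sup>2 + d * p4\<^sup>2 = 0"
    and q: "\<gamma> * q1\<^sup>2 + 2 * \<beta> * q1 * q2 + \<alpha> * q2\<^sup>2 + c * q3\<^sup>2 + d * q4\<^sup>2 = 0"
    and pq: "\<gamma> * p1 * q1 + \<beta> * (p1 * q2 + p2 * q1) + \<alpha> * p2 * q2 + c * p3 * q3 + d * p4 * q4 = 0"
    and indep: "p1 * q2 \<noteq> p2 * q1 \<or> p1 * q3 \<noteq> p3 * q1 \<or> p1 * q4 \<noteq> p4 * q1 \<or>
      p2 * q3 \<noteq> p3 * q2 \<or> p2 * q4 \<noteq> p4 * q2 \<or> p3 * q4 \<noteq> p4 * q3"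
  shows "\<exists>s. (\<alpha> * \<gamma> - \<beta>\<^sup>2) * c * d = s\<^sup>2"
proof -
  let ?D = "(\<alpha> * \<gamma> - \<beta>\<^sup>2) * c * d"
  have *: "\<exists>s. ?D = s\<^sup>2" if "(x - y)\<^sup>2 * ?D = z\<^sup>2" "x \<noteq> y" for x y z
    using that by (intro exI[of _ "z / (x - y)"]) (simp add: power_divide eq_divide_eq mult.commute)
  \<comment> \<open>The two blocks of the form restrict to opposite forms on the plane, so these restrictions
    have equal determinants.\<close>
  have complementary: "(p1 * q2 - p2 * q1)\<^sup>2 * (\<alpha> * \<gamma> - \<beta>\<^sup>2) = c * d * (p3 * q4 - p4 * q3)\<^sup>2"
  proof -
    have "\<gamma> * p1\<^sup>2 + 2 * \<beta> * p1 * p2 + \<alpha> * p2\<^sup>2 = - (c * p3\<^sup>2 + d * p4\<^sup>2)"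
      "\<gamma> * q1\<^sup>2 + 2 * \<beta> * q1 * q2 + \<alpha> * q2\<^sup>2 = - (c * q3\<^sup>2 + d * q4\<^sup>2)"
      "\<gamma> * p1 * q1 + \<beta> * (p1 * q2 + p2 * q1) + \<alpha> * p2 * q2 = - (c * p3 * q3 + d * p4 * q4)"
      using p q pq by (simp_all only: eq_neg_iff_add_eq_0 add.assoc)
    note restrictions = this
    have "(p1 * q2 - p2 * q1)\<^sup>2 * (\<alpha> * \<gamma> - \<beta>\<^sup>2) =
        (\<gamma> * p1\<^sup>2 + 2 * \<beta> * p1 * p2 + \<alpha> * p2\<^sup>2) * (\<gamma> * q1\<^sup>2 + 2 * \<beta> * q1 * q2 + \<alpha> * q2\<^sup>2)
        - (\<gamma> * p1 * q1 + \<beta> * (p1 * q2 + p2 * q1) + \<alpha> * p2 * q2)\<^sup>2"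
      by (simp add: power2_eq_square algebra_simps)
    also have "\<dots> = c * d * (p3 * q4 - p4 * q3)\<^sup>2"
      unfolding restrictions by (simp add: power2_eq_square algebra_simps)
    finally show ?thesis .
  qed
  from indep show ?thesis
  proof (elim disjE)
    assume "p1 * q2 \<noteq> p2 * q1"
    moreover have "(p1 * q2 - p2 * q1)\<^sup>2 * ?D = (c * d * (p3 * q4 - p4 * q3))\<^sup>2"
      using complementary by Groebner_Basis.algebra
    ultimately show ?thesis by (rule *[rotated])
  next
    assume "p3 * q4 \<noteq> p4 * q3"
    moreover have "(p3 * q4 - p4 * q3)\<^sup>2 * ?D = ((\<alpha> * \<gamma> - \<beta>\<^sup>2) * (p1 * q2 - p2 * q1))\<^sup>2"
      using complementary by Groebner_Basis.algebra
    ultimately show ?thesis by (rule *[rotated])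
  next
    assume "p1 * q3 \<noteq> p3 * q1"
    moreover have "(p1 * q3 - p3 * q1)\<^sup>2 * ?D =
        (d * ((\<beta> * p1 + \<alpha> * p2) * q4 - (\<beta> * q1 + \<alpha> * q2) * p4))\<^sup>2"
      using p q pq by Groebner_Basis.algebra
    ultimately show ?thesis by (rule *[rotated])
  next
    assume "p1 * q4 \<noteq> p4 * q1"
    moreover have "(p1 * q4 - p4 * q1)\<^sup>2 * ?D =
        (c * ((\<beta> * p1 + \<alpha> * p2) * q3 - (\<beta> * q1 + \<alpha> * q2) * p3))\<^sup>2"
      using p q pq by Groebner_Basis.algebra
    ultimately show ?thesis by (rule *[rotated])
  next
    assume "p2 * q3 \<noteq> p3 * q2"
    moreover have "(p2 * q3 - p3 * q2)\<^sup>2 * ?D =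
        (d * ((\<gamma> * p1 + \<beta> * p2) * q4 - (\<gamma> * q1 + \<beta> * q2) * p4))\<^sup>2"
      using p q pq by Groebner_Basis.algebra
    ultimately show ?thesis by (rule *[rotated])
  next
    assume "p2 * q4 \<noteq> p4 * q2"
    moreover have "(p2 * q4 - p4 * q2)\<^sup>2 * ?D =
        (c * ((\<gamma> * p1 + \<beta> * p2) * q3 - (\<gamma> * q1 + \<beta> * q2) * p3))\<^sup>2"
      using p q pq by Groebner_Basis.algebra
    ultimately show ?thesis by (rule *[rotated])
  qed
qed

section \<open>Conjugate pairs of points\<close>

lemma conic_nonneg: "4 * x\<^sup>2 - 2 * x * y + y\<^sup>2 - 2 * y * z + 2 * z\<^sup>2 \<ge> (0::'a::linordered_field)"
proof -
  have "4 * x\<^sup>2 - 2 * x * y + y\<^sup>2 - 2 * y * z + 2 * z\<^sup>2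
      = (y - x - z)\<^sup>2 + (x - z)\<^sup>2 + 2 * x\<^sup>2"
    by (simp add: power2_eq_square algebra_simps)
  then show ?thesis by (simp only:) (intro add_nonneg_nonneg, auto)
qed

lemma conic_eq_0:
  fixes x y z :: "'a::linordered_field"
  assumes "4 * x\<^sup>2 - 2 * x * y + y\<^sup>2 - 2 * y * z + 2 * z\<^sup>2 = 0"
  shows "x = 0" "y = 0" "z = 0"
proof -
  have *: "(y - x - z)\<^sup>2 + (x - z)\<^sup>2 + 2 * x\<^sup>2 = 0"
    using assms by (simp add: power2_eq_square algebra_simps)
  show "x = 0" "y = 0" "z = 0" using * by (auto simp: add_nonneg_eq_0_iff)
qed


text \<open>
  The hypotheses say that the rational part and the coefficient of \<open>\<surd>D\<close> vanish when \<open>p + q \<surd>D\<close> is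
  inserted into either equation of the curve. In the main case
  \<open>u\<close> is chosen so that the member \<open>G\<close> of the pencil vanishes at \<open>q\<close>; the hypotheses then make it vanish
  on the whole plane spanned by \<open>p\<close> and \<open>q\<close>.
\<close>

lemma conjugate_pair_zero:
  fixes p1 p2 p3 p4 q1 q2 q3 q4 D :: rat
  defines "A \<equiv> \<lambda>x y z w. 2 * x\<^sup>2 + 3 * x * y + y * z - z\<^sup>2 + w\<^sup>2"
    and "B \<equiv> \<lambda>x y z. 4 * x\<^sup>2 - 2 * x * y + y\<^sup>2 - 2 * y * z + 2 * z\<^sup>2"
  assumes D: "D \<noteq> 0"
    and A: "A p1 p2 p3 p4 + D * A q1 q2 q3 q4 = 0"
    and B: "B p1 p2 p3 + D * B q1 q2 q3 = 0"
    and Apq: "4 * p1 * q1 + 3 * (p1 * q2 + p2 * q1) + (p2 * q3 + p3 * q2) - 2 * p3 * q3 + 2 * p4 * q4 = 0"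
    and Bpq: "4 * p1 * q1 - (p1 * q2 + p2 * q1) + p2 * q2 - (p2 * q3 + p3 * q2) + 2 * p3 * q3 = 0"
  shows "p1 = 0 \<and> p2 = 0 \<and> p3 = 0 \<and> p4 = 0 \<and> q1 = 0 \<and> q2 = 0 \<and> q3 = 0 \<and> q4 = 0"
proof (cases "B q1 q2 q3 = 0")
  case True
  then have q: "q1 = 0" "q2 = 0" "q3 = 0" using conic_eq_0 unfolding B_def by blast+
  have "B p1 p2 p3 = 0" using B True by simp
  then have p: "p1 = 0" "p2 = 0" "p3 = 0" using conic_eq_0 unfolding B_def by blast+
  have "p4 * q4 = 0" "p4\<^sup>2 + D * q4\<^sup>2 = 0" using A Apq by (simp_all add: p q A_def)
  then show ?thesis using p q D by auto
next
  case False
  define u where "u = - 1 - 2 * A q1 q2 q3 q4 / B q1 q2 q3"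
  define G where "G = (\<lambda>x y z w. (2 * x + y)\<^sup>2 + 4 * x\<^sup>2 + 2 * w\<^sup>2 + u * B x y z)"
  have G: "G x y z w = 2 * A x y z w + (1 + u) * B x y z" for x y z w
    by (simp add: G_def A_def B_def power2_eq_square algebra_simps)
  have Gq: "G q1 q2 q3 q4 = 0" using False by (simp add: G u_def)
  have "G p1 p2 p3 p4 + D * G q1 q2 q3 q4 = 2 * (A p1 p2 p3 p4 + D * A q1 q2 q3 q4)
      + (1 + u) * (B p1 p2 p3 + D * B q1 q2 q3)"
    unfolding G by (simp add: algebra_simps)
  then have Gp: "G p1 p2 p3 p4 = 0" using A B Gq by simp
  have Gzero: "x = 0" "y = 0" "w = 0" if "G x y z w = 0" "u \<ge> 0" for x y z w
  proof -
    have "u * B x y z \<ge> 0" using conic_nonneg[of x y z] that by (simp add: B_def)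
    then have "(2 * x + y)\<^sup>2 = 0 \<and> x\<^sup>2 = 0 \<and> w\<^sup>2 = 0"
      using that(1) zero_le_power2[of "2 * x + y"] zero_le_power2[of x] zero_le_power2[of w]
      unfolding G_def by linarith
    then show "x = 0" "y = 0" "w = 0" by auto
  qed
  have "u < 0"
  proof (rule ccontr)
    assume "\<not> u < 0"
    then have u: "u \<ge> 0" by simp
    note z = Gzero[OF Gp u] Gzero[OF Gq u]
    have "p3 * q3 = 0" "p3\<^sup>2 + D * q3\<^sup>2 = 0" using A Apq by (simp_all add: z A_def)
    then have "q3 = 0" using D by auto
    then show False using False by (simp add: B_def z)
  qed
  have "\<exists>s. ((2 + u) * (16 + 8 * u) - (4 - 2 * u)\<^sup>2) * u * 4 = s\<^sup>2"
  proof (rule isotropic_plane_det_square)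
    \<comment> \<open>Completing the square in \<open>z\<close> splits off \<open>x, y\<close>; doubling \<open>G\<close> avoids fractions.\<close>
    have G2: "(16 + 8 * u) * x\<^sup>2 + 2 * (4 - 2 * u) * x * y + (2 + u) * y\<^sup>2
        + u * (2 * z - y)\<^sup>2 + 4 * w\<^sup>2 = 2 * G x y z w" for x y z w
      unfolding G_def B_def by (simp add: power2_eq_square algebra_simps)
    show "(16 + 8 * u) * p1\<^sup>2 + 2 * (4 - 2 * u) * p1 * p2 + (2 + u) * p2\<^sup>2
        + u * (2 * p3 - p2)\<^sup>2 + 4 * p4\<^sup>2 = 0"
      unfolding G2 Gp by simp
    show "(16 + 8 * u) * q1\<^sup>2 + 2 * (4 - 2 * u) * q1 * q2 + (2 + u) * q2\<^sup>2
        + u * (2 * q3 - q2)\<^sup>2 + 4 * q4\<^sup>2 = 0"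
      unfolding G2 Gq by simp
    have "(16 + 8 * u) * p1 * q1 + (4 - 2 * u) * (p1 * q2 + p2 * q1) + (2 + u) * p2 * q2
        + u * (2 * p3 - p2) * (2 * q3 - q2) + 4 * p4 * q4
      = 2 * (4 * p1 * q1 + 3 * (p1 * q2 + p2 * q1) + (p2 * q3 + p3 * q2) - 2 * p3 * q3 + 2 * p4 * q4)
      + 2 * (1 + u) * (4 * p1 * q1 - (p1 * q2 + p2 * q1) + p2 * q2 - (p2 * q3 + p3 * q2) + 2 * p3 * q3)"
      by (simp add: algebra_simps)
    then show "(16 + 8 * u) * p1 * q1 + (4 - 2 * u) * (p1 * q2 + p2 * q1) + (2 + u) * p2 * q2
        + u * (2 * p3 - p2) * (2 * q3 - q2) + 4 * p4 * q4 = 0"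
      unfolding Apq Bpq by simp
    show "p1 * q2 \<noteq> p2 * q1 \<or> p1 * (2 * q3 - q2) \<noteq> (2 * p3 - p2) * q1 \<or> p1 * q4 \<noteq> p4 * q1 \<or>
        p2 * (2 * q3 - q2) \<noteq> (2 * p3 - p2) * q2 \<or> p2 * q4 \<noteq> p4 * q2 \<or>
        (2 * p3 - p2) * q4 \<noteq> p4 * (2 * q3 - q2)"
    \<comment> \<open>If \<open>p\<close> were proportional to \<open>q\<close>, orthogonality with respect to \<open>B\<close> and \<open>B(q) \<noteq> 0\<close> would
      annihilate the first three coordinates of \<open>p\<close>, and then \<open>B(p) + D B(q) = 0\<close> fails.\<close>
    proof (rule ccontr, simp only: de_Morgan_disj not_not, elim conjE)
      assume 1: "p1 * q2 = p2 * q1" and 2: "p1 * (2 * q3 - q2) = (2 * p3 - p2) * q1"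
        and 3: "p2 * (2 * q3 - q2) = (2 * p3 - p2) * q2"
      have 4: "p1 * q3 = p3 * q1" using 1 2 by Groebner_Basis.algebra
      have 5: "p2 * q3 = p3 * q2" using 3 by Groebner_Basis.algebra
      have "p1 * B q1 q2 q3 = 0" using Bpq 1 4 unfolding B_def by Groebner_Basis.algebra
      moreover have "p2 * B q1 q2 q3 = 0" using Bpq 1 5 unfolding B_def by Groebner_Basis.algebra
      moreover have "p3 * B q1 q2 q3 = 0" using Bpq 4 5 unfolding B_def by Groebner_Basis.algebra
      ultimately have "p1 = 0" "p2 = 0" "p3 = 0" using False by auto
      then have "D * B q1 q2 q3 = 0" using B by (simp add: B_def)
      then show False using False D by simp
    qed
  qed
  then obtain s where s: "((2 + u) * (16 + 8 * u) - (4 - 2 * u)\<^sup>2) * u * 4 = s\<^sup>2" ..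
  have "16 * (u * (u\<^sup>2 + 12 * u + 4)) = s\<^sup>2"
    unfolding s[symmetric] by (simp add: power2_eq_square algebra_simps)
  then have "u * (u\<^sup>2 + 12 * u + 4) = (s / 4)\<^sup>2" by (simp add: power_divide)
  then show ?thesis using negative_component_no_rational_point[OF \<open>u < 0\<close>] by blast
qed

section \<open>Fields of degree at most two\<close>

interpretation C: domain complex_field
  by (rule field.axioms(1)) (rule field_from_type_algebra)

lemma complex_field_simps [simp]:
  "carrier complex_field = UNIV" "monoid.mult complex_field = (*)" "ring.add complex_field = (+)"
  "one complex_field = 1" "zero complex_field = 0"
  by (simp_all add: ring_of_type_algebra_def)

lemma complex_field_uminus [simp]: "a_inv complex_field x = - x"
  by (rule C.minus_equality) auto

lemma complex_field_inverse: "x \<noteq> 0 \<Longrightarrow> m_inv complex_field x = inverse x"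
  by (rule C.comm_inv_char) auto

lemma complex_field_power [simp]: "x [^]\<^bsub>complex_field\<^esub> (n::nat) = x ^ n"
  by (induction n) (simp_all add: nat_pow_def mult.commute)

lemma subfield_Rats: "subfield (\<rat> :: complex set) complex_field"
proof (rule field.subfieldI'[OF field_from_type_algebra])
  show "subring (\<rat> :: complex set) complex_field"
    by (rule C.subringI) auto
  show "inv\<^bsub>complex_field\<^esub> k \<in> \<rat>" if "k \<in> \<rat> - {\<zero>\<^bsub>complex_field\<^esub>}" for k :: complex
    using that by (simp add: complex_field_inverse)
qed


lemma dimension_SucE:
  assumes "C.dimension (Suc n) K E"
  obtains v F where "C.dimension n K F" "E = {k * v + x | k x. k \<in> K \<and> x \<in> F}"
  using assms
proof (cases rule: C.dimension.cases)
  case (Suc_dim v F)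
  moreover have "C.line_extension K v F = {k * v + x | k x. k \<in> K \<and> x \<in> F}"
    unfolding set_eq_iff C.line_extension_mem_iff by (simp, blast)
  ultimately show ?thesis using that by auto
qed

lemma dimension_1E:
  assumes "C.dimension (Suc 0) K E"
  obtains v where "E = {k * v | k. k \<in> K}"
proof -
  obtain v F where F: "C.dimension 0 K F" and E: "E = {k * v + x | k x. k \<in> K \<and> x \<in> F}"
    using assms by (rule dimension_SucE)
  from F have "F = {0}" by cases simp
  then have "E = {k * v | k. k \<in> K}" unfolding E by auto
  then show thesis by (rule that)
qed

lemma dimension_2E:
  assumes "C.dimension 2 K E"
  obtains v w where "E = {a * v + b * w | a b. a \<in> K \<and> b \<in> K}"
proof -
  obtain v F where F: "C.dimension (Suc 0) K F" and E: "E = {k * v + x | k x. k \<in> K \<and> x \<in> F}"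
    using assms unfolding numeral_2_eq_2 by (rule dimension_SucE)
  from F obtain w where "F = {k * w | k. k \<in> K}" by (rule dimension_1E)
  then have "E = {a * v + b * w | a b. a \<in> K \<and> b \<in> K}" unfolding E by blast
  then show thesis by (rule that)
qed

text \<open>
  Since \<open>1\<close> is a combination of \<open>v\<close> and \<open>w\<close>, it can replace one of them in the spanning pair. The
  other one, \<open>g\<close>, then satisfies a quadratic equation, and completing the square in it gives \<open>\<theta>\<close>.
\<close>

lemma two_dim_field_is_quadratic:
  fixes v w :: complex
  assumes span: "\<And>x. x \<in> L \<Longrightarrow> \<exists>a\<in>\<rat>. \<exists>b\<in>\<rat>. x = a * v + b * w"
    and v: "v \<in> L" and w: "w \<in> L"
    and one: "1 \<in> L" and mult: "\<And>x y. x \<in> L \<Longrightarrow> y \<in> L \<Longrightarrow> x * y \<in> L"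
  shows "\<exists>\<theta>. \<theta>\<^sup>2 \<in> \<rat> \<and> (\<forall>x\<in>L. \<exists>a\<in>\<rat>. \<exists>b\<in>\<rat>. x = a + b * \<theta>)"
proof -
  have exchange: "\<exists>a\<in>\<rat>. \<exists>b\<in>\<rat>. x = a + b * g"
    if x: "\<exists>a\<in>\<rat>. \<exists>b\<in>\<rat>. x = a * h + b * g"
      and cd: "1 = c * h + d * g" "c \<in> \<rat>" "d \<in> \<rat>" "c \<noteq> 0"
    for x h g c d :: complex
  proof -
    obtain a b where ab: "a \<in> \<rat>" "b \<in> \<rat>" and x: "x = a * h + b * g" using x by blast
    have h: "h = (1 - d * g) / c" unfolding cd(1) using cd(4) by simp
    have "x = a / c + (b - a * d / c) * g"
      unfolding x h by (simp add: diff_divide_distrib right_diff_distrib left_diff_distrib)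
    moreover have "a / c \<in> \<rat>" "b - a * d / c \<in> \<rat>" using ab cd(2,3) by simp_all
    ultimately show ?thesis by blast
  qed
  obtain c d where cd: "c \<in> \<rat>" "d \<in> \<rat>" "1 = c * v + d * w" using span[OF one] by blast
  have "\<exists>g\<in>L. \<forall>x\<in>L. \<exists>a\<in>\<rat>. \<exists>b\<in>\<rat>. x = a + b * g"
  proof (cases "c = 0")
    case False
    have "\<exists>a\<in>\<rat>. \<exists>b\<in>\<rat>. x = a + b * w" if "x \<in> L" for x
      using exchange[OF span[OF that] cd(3) cd(1,2) False] .
    then show ?thesis using w by (intro bexI[of _ w]) auto
  next
    case True
    have d: "d \<noteq> 0"
    proof
      assume "d = 0"
      with True cd(3) have "1 = (0 :: complex)" by (simp only: mult_zero_left add_0_left)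
      then show False by simp
    qed
    have cd': "1 = d * w + c * v" using cd(3) by (simp only: add.commute)
    have "\<exists>a\<in>\<rat>. \<exists>b\<in>\<rat>. x = a + b * v" if "x \<in> L" for x
    proof -
      from span[OF that] obtain a b where "a \<in> \<rat>" "b \<in> \<rat>" "x = b * w + a * v"
        by (metis add.commute)
      then have "\<exists>a\<in>\<rat>. \<exists>b\<in>\<rat>. x = a * w + b * v" by blast
      from exchange[OF this cd' cd(2,1) d] show ?thesis .
    qed
    then show ?thesis using v by (intro bexI[of _ v]) auto
  qed
  then obtain g where g: "g \<in> L" and sub: "\<And>x. x \<in> L \<Longrightarrow> \<exists>a\<in>\<rat>. \<exists>b\<in>\<rat>. x = a + b * g"
    by blast
  obtain r s where rs: "r \<in> \<rat>" "s \<in> \<rat>" and gg: "g * g = r + s * g"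
    using sub[OF mult[OF g g]] by blast
  have "(g - s / 2)\<^sup>2 = g * g - s * g + (s / 2)\<^sup>2" by (simp add: power2_eq_square algebra_simps)
  also have "\<dots> = r + (s / 2)\<^sup>2" unfolding gg by simp
  finally have "(g - s / 2)\<^sup>2 \<in> \<rat>" using rs by simp
  moreover have "\<exists>a\<in>\<rat>. \<exists>b\<in>\<rat>. x = a + b * (g - s / 2)" if "x \<in> L" for x
  proof -
    from sub[OF that] obtain a b where ab: "a \<in> \<rat>" "b \<in> \<rat>" and x: "x = a + b * g" by blast
    have "x = (a + b * (s / 2)) + b * (g - s / 2)" unfolding x by (simp add: algebra_simps)
    moreover have "a + b * (s / 2) \<in> \<rat>" using ab rs by simp
    ultimately show ?thesis using ab by blast
  qed
  ultimately show ?thesis by blast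
qed

lemma degree_le_2_is_quadratic:
  assumes L: "subfield L complex_field" and deg: "has_degree L n" "n \<le> 2"
  shows "\<exists>\<theta>. \<theta>\<^sup>2 \<in> \<rat> \<and> (\<forall>x\<in>L. \<exists>a\<in>\<rat>. \<exists>b\<in>\<rat>. x = a + b * \<theta>)"
proof -
  have R: "subring L complex_field" by (rule subfieldE(1)[OF L])
  have one: "1 \<in> L" using subringE(3)[OF R] by simp
  have mult: "x * y \<in> L" if "x \<in> L" "y \<in> L" for x y
    using subringE(6)[OF R that] by simp
  have dim: "C.dimension n \<rat> L" using deg by (simp add: has_degree_def)
  have "\<exists>v\<in>L. \<exists>w\<in>L. \<forall>x\<in>L. \<exists>a\<in>\<rat>. \<exists>b\<in>\<rat>. x = a * v + b * w"
  proof -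
    consider "n = 0" | "n = Suc 0" | "n = 2" using deg(2) by linarith
    then show ?thesis
    proof cases
      case 1
      then have "C.dimension 0 \<rat> L" using dim by simp
      then have "L = {0}" by cases simp
      then show ?thesis using one by simp
    next
      case 2
      then have "C.dimension (Suc 0) \<rat> L" using dim by simp
      then obtain v where E: "L = {k * v | k. k \<in> \<rat>}" by (rule dimension_1E)
      have "1 * v \<in> L" unfolding E using Rats_1 by blast
      then have v: "v \<in> L" by simp
      have "\<exists>a\<in>\<rat>. \<exists>b\<in>\<rat>. x = a * v + b * v" if "x \<in> L" for x
      proof -
        from that obtain k where k: "k \<in> \<rat>" "x = k * v" unfolding E by blast
        show ?thesis by (rule bexI[OF _ k(1)], rule bexI[of _ 0]) (simp_all add: k(2))
      qed
      then show ?thesis using v by blast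
    next
      case 3
      then have "C.dimension 2 \<rat> L" using dim by simp
      then obtain v w where E: "L = {a * v + b * w | a b. a \<in> \<rat> \<and> b \<in> \<rat>}" by (rule dimension_2E)
      have "1 * v + 0 * w \<in> L" "0 * v + 1 * w \<in> L" unfolding E using Rats_0 Rats_1 by blast+
      then have "v \<in> L" "w \<in> L" by simp_all
      moreover have "\<forall>x\<in>L. \<exists>a\<in>\<rat>. \<exists>b\<in>\<rat>. x = a * v + b * w" unfolding E by blast
      ultimately show ?thesis by blast
    qed
  qed
  then obtain v w where vw: "v \<in> L" "w \<in> L"
    and "\<forall>x\<in>L. \<exists>a\<in>\<rat>. \<exists>b\<in>\<rat>. x = a * v + b * w"
    by blast
  then have span: "\<exists>a\<in>\<rat>. \<exists>b\<in>\<rat>. x = a * v + b * w" if "x \<in> L" for x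
    using that by blast
  show ?thesis
    using two_dim_field_is_quadratic[OF span vw one mult] .
qed

lemma algebraic_in_number_field:
  assumes alg: "(C.algebraic over \<rat>) w"
  shows "\<exists>L n. subfield L complex_field \<and> has_degree L n \<and> w \<in> L"
proof -
  define L where "L = C.simple_extension \<rat> w"
  have "subfield L complex_field"
    unfolding L_def using C.simple_extension_is_subfield[OF subfield_Rats] alg by simp
  moreover have "\<exists>n. has_degree L n"
    unfolding L_def has_degree_def using C.dimension_simple_extension[OF subfield_Rats _ alg] by auto
  moreover have "w \<in> L"
    unfolding L_def by (rule C.simple_extension_mem[OF subfieldE(1)[OF subfield_Rats]]) simp
  ultimately show ?thesis by blast
qed

section \<open>Points on the curve\<close>

text \<open>
  For irrational \<open>\<theta>\<close> the numbers \<open>1\<close> and \<open>\<theta>\<close> are linearly independent over \<open>\<rat>\<close>, so each equation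
  splits into two rational ones. A rational point is the case \<open>q = 0\<close> of the same lemma, for any
  non-zero \<open>D\<close>.
\<close>

lemma no_quadratic_coordinates:
  fixes \<theta> x y z w :: complex
  assumes \<theta>: "\<theta>\<^sup>2 \<in> \<rat>"
    and coords: "\<And>t. t \<in> {x, y, z, w} \<Longrightarrow> \<exists>a\<in>\<rat>. \<exists>b\<in>\<rat>. t = a + b * \<theta>"
    and eq1: "2 * x\<^sup>2 + 3 * x * y + y * z - z\<^sup>2 + w\<^sup>2 = 0"
    and eq2: "4 * x\<^sup>2 - 2 * x * y + y\<^sup>2 - 2 * y * z + 2 * z\<^sup>2 = 0"
  shows "x = 0 \<and> y = 0 \<and> z = 0 \<and> w = 0"
proof (cases "\<theta> \<in> \<rat>")
  case True
  then have "t \<in> \<rat>" if "t \<in> {x, y, z, w}" for t using coords[OF that] by auto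
  then have "x \<in> \<rat>" "y \<in> \<rat>" "z \<in> \<rat>" "w \<in> \<rat>" by simp_all
  then obtain x' y' z' w' :: rat where
    r: "x = of_rat x'" "y = of_rat y'" "z = of_rat z'" "w = of_rat w'"
    by (elim Rats_cases) blast
  have "of_rat (2 * x'\<^sup>2 + 3 * x' * y' + y' * z' - z'\<^sup>2 + w'\<^sup>2) = (0 :: complex)"
    "of_rat (4 * x'\<^sup>2 - 2 * x' * y' + y'\<^sup>2 - 2 * y' * z' + 2 * z'\<^sup>2) = (0 :: complex)"
    using eq1 eq2 by (simp_all add: r of_rat_add of_rat_diff of_rat_mult of_rat_power)
  then show ?thesis
    using conjugate_pair_zero[of 1 x' y' z' w' 0 0 0 0] unfolding r of_rat_eq_0_iff by simp
next
  case False
  have rat: "\<exists>p q :: rat. t = of_rat p + of_rat q * \<theta>" if "t \<in> {x, y, z, w}" for t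
    using coords[OF that] by (auto simp: Rats_def)
  obtain p1 q1 where x: "x = of_rat p1 + of_rat q1 * \<theta>" using rat[of x] by auto
  obtain p2 q2 where y: "y = of_rat p2 + of_rat q2 * \<theta>" using rat[of y] by auto
  obtain p3 q3 where z: "z = of_rat p3 + of_rat q3 * \<theta>" using rat[of z] by auto
  obtain p4 q4 where w: "w = of_rat p4 + of_rat q4 * \<theta>" using rat[of w] by auto
  obtain D where D: "\<theta>\<^sup>2 = of_rat D" using \<theta> by (auto simp: Rats_def)
  have "\<theta> \<noteq> 0" using False by auto
  then have "D \<noteq> 0" using D by auto
  have indep: "r = 0 \<and> s = 0" if "of_rat r + of_rat s * \<theta> = 0" for r s
  proof -
    have "s = 0"
    proof (rule ccontr)
      assume "s \<noteq> 0"
      then have "\<theta> = of_rat (- r / s)"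
        using that by (simp add: of_rat_divide of_rat_minus field_simps add_eq_0_iff)
      then show False using False by simp
    qed
    then show ?thesis using that by simp
  qed
  have "of_rat (2 * p1\<^sup>2 + 3 * p1 * p2 + p2 * p3 - p3\<^sup>2 + p4\<^sup>2
        + D * (2 * q1\<^sup>2 + 3 * q1 * q2 + q2 * q3 - q3\<^sup>2 + q4\<^sup>2))
      + of_rat (4 * p1 * q1 + 3 * (p1 * q2 + p2 * q1) + (p2 * q3 + p3 * q2) - 2 * p3 * q3 + 2 * p4 * q4)
        * \<theta> = 0"
    using eq1[unfolded x y z w] D
    by (simp only: of_rat_add of_rat_diff of_rat_mult of_rat_power of_rat_numeral_eq) Groebner_Basis.algebra
  note A = indep[OF this]
  have "of_rat (4 * p1\<^sup>2 - 2 * p1 * p2 + p2\<^sup>2 - 2 * p2 * p3 + 2 * p3\<^sup>2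
        + D * (4 * q1\<^sup>2 - 2 * q1 * q2 + q2\<^sup>2 - 2 * q2 * q3 + 2 * q3\<^sup>2))
      + of_rat (2 * (4 * p1 * q1 - (p1 * q2 + p2 * q1) + p2 * q2 - (p2 * q3 + p3 * q2) + 2 * p3 * q3))
        * \<theta> = 0"
    using eq2[unfolded x y z w] D
    by (simp only: of_rat_add of_rat_diff of_rat_mult of_rat_power of_rat_numeral_eq) Groebner_Basis.algebra
  note B = indep[OF this]
  have "p1 = 0 \<and> p2 = 0 \<and> p3 = 0 \<and> p4 = 0 \<and> q1 = 0 \<and> q2 = 0 \<and> q3 = 0 \<and> q4 = 0"
    by (rule conjugate_pair_zero[OF \<open>D \<noteq> 0\<close>]) (use A B in auto)
  then show ?thesis by (simp add: x y z w)
qed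

lemma curve_point_equations:
  fixes v :: "complex^4"
  assumes "P \<in> curve_8_48_1_bi_1" "v \<in> P"
  shows "2 * (v $ 1)\<^sup>2 + 3 * v $ 1 * v $ 2 + v $ 2 * v $ 3 - (v $ 3)\<^sup>2 + (v $ 4)\<^sup>2 = 0"
    and "4 * (v $ 1)\<^sup>2 - 2 * v $ 1 * v $ 2 + (v $ 2)\<^sup>2 - 2 * v $ 2 * v $ 3 + 2 * (v $ 3)\<^sup>2 = 0"
  using assms by (auto simp: curve_8_48_1_bi_1_def Let_def)

lemma proj_spaceE:
  assumes "P \<in> proj_space"
  obtains v where "v \<noteq> 0" "P = {c *s v | c. c \<noteq> 0}"
proof -
  obtain v where "v \<noteq> 0" "P = proportional `` {v}"
    using assms unfolding proj_space_def by (auto elim: quotientE)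
  moreover have "proportional `` {v} = {c *s v | c. c \<noteq> 0}"
    by (auto simp: proportional_def)
  ultimately show thesis using that by blast
qed

lemma no_point_over_quadratic_field:
  fixes v :: "complex^4"
  assumes L: "subfield L complex_field" "has_degree L n" "n \<le> 2"
    and P: "P \<in> curve_8_48_1_bi_1" "v \<in> P"
  shows "\<exists>i. v $ i \<notin> L"
proof (rule ccontr)
  assume "\<not> ?thesis"
  then have v: "v $ i \<in> L" for i by blast
  obtain \<theta> where \<theta>: "\<theta>\<^sup>2 \<in> \<rat>" "\<And>x. x \<in> L \<Longrightarrow> \<exists>a\<in>\<rat>. \<exists>b\<in>\<rat>. x = a + b * \<theta>"
    using degree_le_2_is_quadratic[OF L] by blast
  have "v $ 1 = 0 \<and> v $ 2 = 0 \<and> v $ 3 = 0 \<and> v $ 4 = 0"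
    using \<theta> v by (intro no_quadratic_coordinates[OF \<theta>(1)] curve_point_equations[OF P]) auto
  then have "v = 0" by (simp add: vec_eq_iff forall_4)
  moreover have "P \<in> proj_space" using P by (simp add: curve_8_48_1_bi_1_def)
  ultimately show False using P(2) by (elim proj_spaceE) auto
qed

lemma subfield_residue_field: "subfield (residue_field P) complex_field"
  unfolding residue_field_def
  by (rule field.generate_field_is_subfield[OF field_from_type_algebra]) simp

text \<open>
  Dividing by a non-zero coordinate turns all coordinates into generators of the residue field.
\<close>

lemma normalised_representative:
  fixes P :: "(complex^'n) set"
  assumes "P \<in> proj_space"
  shows "\<exists>v. v \<in> P \<and> (\<forall>i. v $ i \<in> residue_field P)"
proof -
  obtain v where v: "v \<noteq> 0" and P: "P = {c *s v | c. c \<noteq> 0}" using assms by (rule proj_spaceE)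
  obtain j where j: "v $ j \<noteq> 0" using v by (auto simp: vec_eq_iff)
  have "1 *s v \<in> P" unfolding P by (intro CollectI exI[of _ 1]) simp
  then have "v \<in> P" by simp
  then have "v $ i / v $ j \<in> residue_field P" for i
    unfolding residue_field_def using j by (intro generate_field.incl) blast
  moreover have "(1 / v $ j) *s v \<in> P" unfolding P using j by (intro CollectI exI[of _ "1 / v $ j"]) simp
  ultimately show ?thesis by (intro exI[of _ "(1 / v $ j) *s v"]) simp_all
qed

text \<open>
  The index is defined as a least element, which is meaningful only if some degree occurs. A point
  is found on the plane \<open>z = 0\<close>: there the second equation is solved by \<open>y = (1 + \<surd>-3) x\<close>, and the first
  one gives \<open>w\<close> as a square root. The field \<open>\<rat>(w)\<close> already contains \<open>y\<close>, since \<open>w\<^sup>2 = -5 - 3 \<surd>-3\<close> when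
  \<open>x = 1\<close>. The representative used has \<open>x = 3\<close>, to avoid fractions.
\<close>

lemma point_over_number_field:
  "\<exists>n L. subfield L complex_field \<and> has_degree L n \<and> points_over curve_8_48_1_bi_1 L \<noteq> {}"
proof -
  define w where "w = csqrt (-5 - 3 * (\<i> * of_real (sqrt 3)))"
  have s: "(\<i> * of_real (sqrt 3))\<^sup>2 = (-3 :: complex)"
    by (simp add: power_mult_distrib flip: of_real_power)
  have w2: "w\<^sup>2 = -5 - 3 * (\<i> * of_real (sqrt 3))" by (simp add: w_def)
  have w: "w\<^sup>2 * w\<^sup>2 + 10 * w\<^sup>2 + 52 = 0" using s unfolding w2 by Groebner_Basis.algebra
  have alg: "(C.algebraic over \<rat>) w"
  proof (rule C.algebraicI)
    show "[1, 0, 10, 0, 52] \<in> carrier (univ_poly complex_field \<rat>)"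
      by (simp add: univ_poly_def polynomial_def)
    show "C.eval [1, 0, 10, 0, 52] w = \<zero>\<^bsub>complex_field\<^esub>"
      using w by (simp add: eval_nat_numeral algebra_simps)
  qed simp
  obtain L n where L: "subfield L complex_field" "has_degree L n" "w \<in> L"
    using algebraic_in_number_field[OF alg] by blast
  have R: "subring L complex_field" by (rule subfieldE(1)[OF L(1)])
  define v :: "complex^4" where "v = (\<chi> i. if i = 1 then 3 else if i = 2 then - (w\<^sup>2 + 2) else if i = 3 then 0 else 3 * w)"
  have v: "v $ 1 = 3" "v $ 2 = - (w\<^sup>2 + 2)" "v $ 3 = 0" "v $ 4 = 3 * w"
    by (simp_all add: v_def)
  have one: "1 \<in> L" and zero: "0 \<in> L" and neg: "\<And>x. x \<in> L \<Longrightarrow> - x \<in> L"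
    and add: "\<And>x y. x \<in> L \<Longrightarrow> y \<in> L \<Longrightarrow> x + y \<in> L"
    and mult: "\<And>x y. x \<in> L \<Longrightarrow> y \<in> L \<Longrightarrow> x * y \<in> L"
    using subringE(2,3,5,6,7)[OF R] by simp_all
  have "1 + 1 \<in> L" "1 + 1 + 1 \<in> L" by (intro add one)+
  then have num: "2 \<in> L" "3 \<in> L" by simp_all
  have vL: "\<forall>i. v $ i \<in> L"
    unfolding forall_4 v power2_eq_square by (intro conjI neg add mult num L(3) zero)
  have "v \<noteq> 0" using v(1) by auto
  define P where "P = proportional `` {v}"
  have P: "P = {c *s v | c. c \<noteq> 0}" unfolding P_def by (auto simp: proportional_def)
  have "P \<in> proj_space" unfolding P_def proj_space_def using \<open>v \<noteq> 0\<close> by (intro quotientI) simp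
  moreover have "2 * (u $ 1)\<^sup>2 + 3 * u $ 1 * u $ 2 + u $ 2 * u $ 3 - (u $ 3)\<^sup>2 + (u $ 4)\<^sup>2 = 0 \<and>
      4 * (u $ 1)\<^sup>2 - 2 * u $ 1 * u $ 2 + (u $ 2)\<^sup>2 - 2 * u $ 2 * u $ 3 + 2 * (u $ 3)\<^sup>2 = 0"
    if "u \<in> P" for u :: "complex^4"
  proof -
    from that obtain c where "u = c *s v" unfolding P by blast
    then have u: "u $ 1 = c * 3" "u $ 2 = - (c * (w\<^sup>2 + 2))" "u $ 3 = 0" "u $ 4 = c * (3 * w)"
      by (simp_all only: vector_smult_component v mult_minus_right mult_zero_right)
    have "4 * (c * 3)\<^sup>2 - 2 * (c * 3) * - (c * (w\<^sup>2 + 2)) + (- (c * (w\<^sup>2 + 2)))\<^sup>2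
        = c\<^sup>2 * (w\<^sup>2 * w\<^sup>2 + 10 * w\<^sup>2 + 52)"
      by (simp add: power2_eq_square algebra_simps)
    then show ?thesis unfolding u w by (simp add: power2_eq_square algebra_simps)
  qed
  ultimately have "P \<in> curve_8_48_1_bi_1"
    unfolding curve_8_48_1_bi_1_def Let_def by blast
  moreover have "1 *s v \<in> P" unfolding P by (intro CollectI exI[of _ 1]) simp
  ultimately have "P \<in> points_over curve_8_48_1_bi_1 L"
    unfolding points_over_def using vL by auto
  then show ?thesis using L by blast
qed

theorem proposition24:
  shows "quadratic_points curve_8_48_1_bi_1 = {} \<and> curve_index curve_8_48_1_bi_1 > 2"
proof
  show "quadratic_points curve_8_48_1_bi_1 = {}"
  proof (rule equals0I)
    fix P assume "P \<in> quadratic_points curve_8_48_1_bi_1"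
    then obtain n where P: "P \<in> curve_8_48_1_bi_1" and n: "has_degree (residue_field P) n" "n \<le> 2"
      by (auto simp: quadratic_points_def points_over_def)
    have "P \<in> proj_space" using P by (simp add: curve_8_48_1_bi_1_def)
    then obtain v :: "complex^4" where "v \<in> P" "\<forall>i. v $ i \<in> residue_field P"
      using normalised_representative by blast
    then show False using no_point_over_quadratic_field[OF subfield_residue_field n P] by blast
  qed
  show "curve_index curve_8_48_1_bi_1 > 2"
  proof (rule ccontr)
    assume "\<not> ?thesis"
    then have le: "curve_index curve_8_48_1_bi_1 \<le> 2" by simp
    obtain L where L: "subfield L complex_field" "has_degree L (curve_index curve_8_48_1_bi_1)"
      and "points_over curve_8_48_1_bi_1 L \<noteq> {}"
      using LeastI_ex[OF point_over_number_field] unfolding curve_index_def by blast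
    then obtain P and v :: "complex^4" where "P \<in> curve_8_48_1_bi_1" "v \<in> P" "\<forall>i. v $ i \<in> L"
      by (auto simp: points_over_def)
    then show False using no_point_over_quadratic_field[OF L le] by blast
  qed
qed

end
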